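(* Let $r>0$, $r\neq1$, and for measurable $g$ on $(0,\infty)$ let $$F[g](x)=\int_0^x y^{-1}g(y)\,dy\ \text{ if } r>1,\qquad F[g](x)=\int_x^\infty y^{-1}g(y)\,dy\ \text{ if } r<1.$$ For $\psi\in\Psi(1,\infty)$ let $\psi_1(p)=p\,\psi(p)$. Then for all $\psi\in\Psi(1,\infty)$ and $g\in G(\psi)$ $$\|F[g]\|G(\psi_1)\le\frac{1}{|r-1|}\,\|g\|G(\psi),$$ and the constant $1/|r-1|$ is the best possible, i.e. $$\sup_{\psi\in\Psi(1,\infty)}\ \sup_{g\in G(\psi),\,g\neq0}\frac{\|F[g]\|G(\psi_1)}{\|g\|G(\psi)}=\frac1{|r-1|}.$$
   Context: The space is $(0,\infty)$ with the weighted measure $\mu_r(A)=\int_A x^{-r}\,dx$, and $|h|_{p,r}=\bigl(\int_0^\infty x^{-r}|h(x)|^p\,dx\bigr)^{1/p}$. $\Psi(1,\infty)$ is the set of continuous positive functions $\psi$ on $(1,\infty)$ such that the limits $\psi(1+0)$ and $\psi(\infty-0)$ exist (finite or infinite), $\inf_{p\in(1,\infty)}\psi(p)>0$, and both limits are positive. $G(\psi)$ is the space of measurable $g$ with $\|g\|G(\psi)=\sup_{p\in(1,\infty)}|g|_{p,r}/\psi(p)<\infty$. *)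

theory Defs
  imports "HOL-Analysis.Analysis"
begin

text \<open>
  Functions on the half-line are total functions on the reals of which only the values on
  \<open>{0<..}\<close> matter. Measurability is Lebesgue measurability on the half-line.
\<close>

text \<open>The measure \<open>x\<^sup>-\<^sup>r dx\<close> on the half-line.\<close>

definition weighted_measure :: "real \<Rightarrow> real measure" where
  "weighted_measure r = density (lebesgue_on {0<..}) (\<lambda>x. ennreal (x powr (- r)))"

definition ennreal_powr :: "ennreal \<Rightarrow> real \<Rightarrow> ennreal" where
  "ennreal_powr a s = (if a = \<infinity> then \<infinity> else ennreal (enn2real a powr s))"

text \<open>The norm \<open>|h|\<^bsub>p,r\<^esub>\<close>, with the value \<open>\<infinity>\<close> if \<open>h\<close> is not in the weighted \<open>L\<^sup>p\<close> space.\<close>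

definition weighted_norm :: "real \<Rightarrow> real \<Rightarrow> (real \<Rightarrow> real) \<Rightarrow> ennreal" where
  "weighted_norm p r h =
     ennreal_powr (\<integral>\<^sup>+x. ennreal (\<bar>h x\<bar> powr p) \<partial>weighted_measure r) (1 / p)"

text \<open>The class \<open>\<Psi>(1,\<infinity>)\<close>; the limits at both ends are taken in the extended reals.\<close>

definition Psi_class :: "(real \<Rightarrow> real) set" where
  "Psi_class = {\<psi>. continuous_on {1<..} \<psi> \<and> (\<forall>p>1. 0 < \<psi> p) \<and>
     (\<exists>L::ereal. ((\<lambda>p. ereal (\<psi> p)) \<longlongrightarrow> L) (at_right 1) \<and> 0 < L) \<and>
     (\<exists>L::ereal. ((\<lambda>p. ereal (\<psi> p)) \<longlongrightarrow> L) at_top \<and> 0 < L) \<and>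
     0 < (INF p\<in>{1<..}. \<psi> p)}"

definition grand_norm :: "real \<Rightarrow> (real \<Rightarrow> real) \<Rightarrow> (real \<Rightarrow> real) \<Rightarrow> ennreal" where
  "grand_norm r \<psi> g = (SUP p\<in>{1<..}. weighted_norm p r g / ennreal (\<psi> p))"

definition grand_space :: "real \<Rightarrow> (real \<Rightarrow> real) \<Rightarrow> (real \<Rightarrow> real) set" where
  "grand_space r \<psi> = {g \<in> borel_measurable (weighted_measure r). grand_norm r \<psi> g < \<infinity>}"

definition hardy_domain :: "real \<Rightarrow> real \<Rightarrow> real set" where
  "hardy_domain r x = (if 1 < r then {0<..<x} else {x<..})"

text \<open>
  The Bochner integral is \<open>0\<close> when the integrand is not absolutely integrable, so integrability
  over \<open>hardy_domain r x\<close> has to be asserted separately.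
\<close>

definition hardy_op :: "real \<Rightarrow> (real \<Rightarrow> real) \<Rightarrow> real \<Rightarrow> real" where
  "hardy_op r g x = (LINT y:hardy_domain r x|lebesgue. inverse y * g y)"

end

theory Submission
  imports Defs "HOL-Real_Asymp.Real_Asymp"
begin

text \<open>
  Put \<open>c = \<bar>r - 1\<bar>\<close> and \<open>s = (r - 1) / p\<close>. The power mean inequality for \<open>\<bar>g y\<bar> y\<^sup>-\<^sup>s\<close>
  against the finite measure \<open>y\<^sup>s\<^sup>-\<^sup>1 dy\<close> on \<open>hardy_domain r x\<close>, followed by Tonelli, gives Hardy's
  inequality with the sharp constant \<open>p / c\<close> for each \<open>p\<close>; the factor \<open>p\<close> is absorbed by
  \<open>p * \<psi> p\<close>. Sharpness comes from \<open>p \<rightarrow> 1\<close>: for \<open>g x = x powr (r - 1)\<close> on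
  \<open>hardy_domain r 1\<close> one has \<open>hardy_op r g \<ge> g / c\<close>, and \<open>\<psi> p = max 1 (weighted_norm p r g)\<close>
  is admissible.
\<close>

section \<open>Power mean inequality over a finite measure\<close>

text \<open>Convexity: \<open>t powr p\<close> lies above its tangent at \<open>a\<close>. The terms
  are arranged so that nothing is subtracted, which lets the inequality be integrated in
  \<open>ennreal\<close>. Young's inequality covers \<open>a = 0\<close> and \<open>t = 0\<close>
  too.\<close>

lemma powr_tangent:
  fixes p a t :: real
  assumes "1 < p" "0 \<le> a" "0 \<le> t"
  shows "p * a powr (p - 1) * t \<le> t powr p + (p - 1) * a powr p"
proof -
  define q where "q = p / (p - 1)"
  have q: "1 < q" "1 / p + 1 / q = 1"
    using assms by (auto simp: q_def field_simps)
  have "t * a powr (p - 1) \<le> t powr p / p + (a powr (p - 1)) powr q / q"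
    using assms q by (intro Youngs_inequality) auto
  also have "(a powr (p - 1)) powr q = a powr p"
    using assms by (simp add: powr_powr q_def)
  finally show ?thesis
    using assms by (simp add: q_def field_simps)
qed

text \<open>Jensen's inequality for the power \<open>p\<close>, obtained by integrating the tangent
  inequality. A real lower bound \<open>A\<close> stands for the integral of \<open>h\<close>, which
  may be infinite.\<close>

lemma nn_integral_power_mean:
  fixes h :: "'a \<Rightarrow> real" and p K A :: real
  assumes "1 < p" and [measurable]: "h \<in> borel_measurable M" and h: "\<And>x. x \<in> space M \<Longrightarrow> 0 \<le> h x"
    and K: "0 < K" "emeasure M (space M) = ennreal K"
    and A: "0 \<le> A" "ennreal A \<le> (\<integral>\<^sup>+x. ennreal (h x) \<partial>M)"
  shows "ennreal (A powr p) \<le> ennreal (K powr (p - 1)) * (\<integral>\<^sup>+x. ennreal (h x powr p) \<partial>M)"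
proof (cases "\<integral>\<^sup>+x. ennreal (h x powr p) \<partial>M")
  case (real J)
  \<comment> \<open>The tangent is taken at the mean value. Then \<open>A = a * K\<close>, so the
    integrated inequality collapses to \<open>a powr p * K \<le> J\<close>.\<close>
  define a where "a = A / K"
  have a: "0 \<le> a" using A K by (simp add: a_def)
  have "ennreal (p * a powr (p - 1) * A) = ennreal (p * a powr (p - 1)) * ennreal A"
    using assms a by (subst ennreal_mult[symmetric]) auto
  also have "\<dots> \<le> ennreal (p * a powr (p - 1)) * (\<integral>\<^sup>+x. ennreal (h x) \<partial>M)"
    using A by (intro mult_left_mono) auto
  also have "\<dots> = (\<integral>\<^sup>+x. ennreal (p * a powr (p - 1) * h x) \<partial>M)"
    using assms h by (subst nn_integral_cmult[symmetric]) (auto intro!: nn_integral_cong simp: ennreal_mult')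
  also have "\<dots> \<le> (\<integral>\<^sup>+x. ennreal (h x powr p) + ennreal ((p - 1) * a powr p) \<partial>M)"
  proof (rule nn_integral_mono)
    fix x assume "x \<in> space M"
    then show "ennreal (p * a powr (p - 1) * h x) \<le> ennreal (h x powr p) + ennreal ((p - 1) * a powr p)"
      using powr_tangent[of p a "h x"] h a assms(1) by (subst ennreal_plus[symmetric]) (auto simp del: ennreal_plus intro!: ennreal_leI)
  qed
  also have "\<dots> = ennreal (J + (p - 1) * a powr p * K)"
    using real assms by (simp add: nn_integral_add ennreal_mult'[symmetric])
  finally have "p * a powr (p - 1) * A \<le> J + (p - 1) * a powr p * K"
    using real K assms(1) by (subst (asm) ennreal_le_iff) auto
  moreover have "a powr (p - 1) * A = a powr p * K"
    using A K by (cases "A = 0") (auto simp: a_def powr_diff)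
  ultimately have "p * (a powr p * K) \<le> J + (p - 1) * (a powr p * K)"
    by (simp only: mult.assoc)
  then have "a powr p * K \<le> J"
    by (simp add: algebra_simps)
  then have "K powr (p - 1) * (a powr p * K) \<le> K powr (p - 1) * J"
    by (intro mult_left_mono) auto
  moreover have "K powr (p - 1) * (a powr p * K) = A powr p"
    using A K by (simp add: a_def powr_divide powr_diff)
  ultimately show ?thesis
    using real by (simp add: ennreal_mult[symmetric] ennreal_leI)
qed (use K in \<open>auto simp: ennreal_mult_top\<close>)

section \<open>Hardy domains and integrals of powers over them\<close>

text \<open>
  The reflection \<open>r \<mapsto> 2 - r\<close> swaps the cases \<open>r > 1\<close> and \<open>r < 1\<close>, so both inner integrals in
  Tonelli's theorem are instances of \<open>nn_integral_hardy_domain\<close>.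
\<close>

lemma mem_hardy_domain_dual:
  assumes "r \<noteq> 1" "0 < x" "0 < y"
  shows "y \<in> hardy_domain r x \<longleftrightarrow> x \<in> hardy_domain (2 - r) y"
  using assms by (auto simp: hardy_domain_def)

lemma hardy_domain_subset: "0 < x \<Longrightarrow> hardy_domain r x \<subseteq> {0<..}"
  by (auto simp: hardy_domain_def)

lemma hardy_domain_sets [measurable]: "hardy_domain r x \<in> sets lebesgue"
  by (auto simp: hardy_domain_def)

text \<open>The sign condition says that \<open>u\<close> is positive on a domain reaching down to 0
  and negative on one reaching up to \<infinity>. This is convergence at the singular end, and
  \<open>\<bar>u\<bar>\<close> merges the two antiderivative values.\<close>

lemma nn_integral_hardy_domain:
  assumes "0 < x" "0 < u * (r - 1)"
  shows "(\<integral>\<^sup>+y. ennreal (y powr (u - 1)) * indicator (hardy_domain r x) y \<partial>lebesgue_on {0<..})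
    = ennreal (x powr u / \<bar>u\<bar>)"
proof -
  have "(\<integral>\<^sup>+y. ennreal (y powr (u - 1)) * indicator (hardy_domain r x) y \<partial>lebesgue_on {0<..})
      = (\<integral>\<^sup>+y. ennreal (y powr (u - 1)) * indicator (hardy_domain r x) y \<partial>lebesgue)"
    using hardy_domain_subset[OF assms(1), of r]
    by (subst nn_integral_restrict_space) (auto intro!: nn_integral_cong simp: indicator_def)
  also have "\<dots> = ennreal (x powr u / \<bar>u\<bar>)"
  proof -
    have "((\<lambda>y. y powr (u - 1)) has_integral (x powr u / \<bar>u\<bar>)) (hardy_domain r x)"
    proof (cases "1 < r")
      case True
      then have "0 < u" using assms by (simp add: zero_less_mult_iff)
      then have "((\<lambda>y. y powr (u - 1)) has_integral (x powr u / u)) {0..x}"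
        using has_integral_powr_from_0[of "u - 1" x] assms by simp
      then show ?thesis
        using True \<open>0 < u\<close> by (simp add: has_integral_Icc_iff_Ioo hardy_domain_def)
    next
      case False
      then have "u < 0" using assms by (simp add: zero_less_mult_iff)
      then have "((\<lambda>y. y powr (u - 1)) has_integral (x powr u / \<bar>u\<bar>)) {x..}"
        using has_integral_powr_to_inf[of "u - 1" x] assms by simp
      \<comment> \<open>The closed and the open ray differ only in the null set
        \<open>{x}\<close>.\<close>
      then have "((\<lambda>y. y powr (u - 1)) has_integral (x powr u / \<bar>u\<bar>)) {x<..}"
        by (rule has_integral_spike_set_eq[THEN iffD1, rotated 2]) (auto intro: negligible_subset[of "{x}"])
      then show ?thesis
        using False by (simp add: hardy_domain_def)
    qed
    then show ?thesis
      by (simp add: nn_integral_completion nn_integral_has_integral_lebesgue')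
  qed
  finally show ?thesis .
qed

section \<open>Hardy's inequality for the kernel integral\<close>

lemma ident_measurable_lebesgue_on [measurable]: "(\<lambda>x. x) \<in> borel_measurable (lebesgue_on S)"
  by (intro measurable_restrict_space1 measurable_completion) simp

lemma indicator_hardy_domain_measurable [measurable]:
  "indicator (hardy_domain r x) \<in> borel_measurable (lebesgue_on S)"
  by (intro measurable_restrict_space1 borel_measurable_indicator) simp

text \<open>Power mean inequality for \<open>h\<close> under \<open>N\<close>, whose density times
  \<open>h\<close> gives back \<open>\<bar>g y\<bar> / y\<close>. Among all exponents in place of
  \<open>s\<close>, the value \<open>(r - 1) / p\<close> minimizes the constant that remains after
  the later integration in \<open>x\<close>.\<close>

lemma hardy_kernel_pointwise:
  fixes r p x A :: real and g :: "real \<Rightarrow> real"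
  defines "s \<equiv> (r - 1) / p"
  assumes "r \<noteq> 1" "1 < p" "0 < x" "0 \<le> A"
    and [measurable]: "g \<in> borel_measurable (lebesgue_on {0<..})"
    and A: "ennreal A \<le> (\<integral>\<^sup>+y. ennreal (\<bar>g y\<bar> / y) * indicator (hardy_domain r x) y \<partial>lebesgue_on {0<..})"
  shows "ennreal (A powr p) \<le> ennreal ((x powr s / \<bar>s\<bar>) powr (p - 1)) *
    (\<integral>\<^sup>+y. ennreal (y powr (s - r) * \<bar>g y\<bar> powr p) * indicator (hardy_domain r x) y \<partial>lebesgue_on {0<..})"
proof -
  define N where "N = density (lebesgue_on {0<..})
    (\<lambda>y. ennreal (y powr (s - 1)) * indicator (hardy_domain r x) y)"
  define h where "h = (\<lambda>y. \<bar>g y\<bar> * y powr (- s))"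
  have s: "s \<noteq> 0" "0 < s * (r - 1)"
    using assms by (auto simp: s_def zero_less_mult_iff zero_less_divide_iff)
  have h_meas [measurable]: "h \<in> borel_measurable (lebesgue_on {0<..})"
    unfolding h_def by measurable
  have "emeasure N (space N) = ennreal (x powr s / \<bar>s\<bar>)"
    unfolding N_def nn_integral_hardy_domain[OF assms(4) s(2), symmetric]
    by (subst emeasure_density) (auto intro!: nn_integral_cong)
  moreover have "(\<integral>\<^sup>+y. ennreal (h y) \<partial>N)
      = (\<integral>\<^sup>+y. ennreal (\<bar>g y\<bar> / y) * indicator (hardy_domain r x) y \<partial>lebesgue_on {0<..})"
    unfolding N_def
    by (subst nn_integral_density, measurable)
      (auto intro!: nn_integral_cong
        simp: h_def indicator_def powr_diff powr_minus divide_simps simp flip: ennreal_mult)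
  moreover have "(\<integral>\<^sup>+y. ennreal (h y powr p) \<partial>N)
      = (\<integral>\<^sup>+y. ennreal (y powr (s - r) * \<bar>g y\<bar> powr p) * indicator (hardy_domain r x) y \<partial>lebesgue_on {0<..})"
  proof -
    have "y powr (s - 1) * h y powr p = y powr (s - r) * \<bar>g y\<bar> powr p" if "0 < y" for y
    proof -
      have "y powr (s - 1) * h y powr p = y powr (s - 1) * y powr (- s * p) * \<bar>g y\<bar> powr p"
        using that by (simp add: h_def powr_mult powr_powr)
      \<comment> \<open>Since \<open>s * p = r - 1\<close>, the exponent
        \<open>s - 1 - s * p\<close> equals \<open>s - r\<close>.\<close>
      also have "y powr (s - 1) * y powr (- s * p) = y powr (s - r)"
        using assms by (simp add: powr_add[symmetric] s_def)
      finally show ?thesis .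
    qed
    then show ?thesis
      unfolding N_def
      by (subst nn_integral_density, measurable)
        (auto intro!: nn_integral_cong simp: indicator_def simp flip: ennreal_mult)
  qed
  ultimately show ?thesis
    using nn_integral_power_mean[of p h N "x powr s / \<bar>s\<bar>" A] assms s
    by (auto simp: N_def h_def)
qed

text \<open>Serves Tonelli's theorem and the measurability of \<open>hardy_op r g\<close>. A
  countable Borel cover by sets of finite \<open>lborel\<close> measure also works for the
  completion.\<close>

lemma sigma_finite_lebesgue_on:
  fixes S :: "'a::euclidean_space set"
  assumes "S \<in> sets lebesgue"
  shows "sigma_finite_measure (lebesgue_on S)"
proof -
  obtain A :: "'a set set" where A: "countable A" "A \<subseteq> sets lborel" "\<Union>A = space lborel"
      "\<forall>a\<in>A. emeasure lborel a \<noteq> \<infinity>"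
    using lborel.sigma_finite_countable by blast
  have "sigma_finite_measure (lebesgue :: 'a measure)"
    using A by (intro sigma_finite_measure.intro exI[of _ A]) (auto simp: main_part_sets)
  then show ?thesis
    using assms by (rule sigma_finite_measure_restrict_space)
qed

text \<open>
  Bounding an arbitrary \<open>T\<close> instead of the kernel integral itself avoids powers of
  \<^typ>\<open>ennreal\<close> values that are not yet known to be finite.
\<close>

lemma nn_integral_hardy:
  fixes r p :: real and g T :: "real \<Rightarrow> real"
  assumes "r \<noteq> 1" "1 < p"
    and [measurable]: "g \<in> borel_measurable (lebesgue_on {0<..})"
    and T: "\<And>x. 0 < x \<Longrightarrow> 0 \<le> T x"
      "\<And>x. 0 < x \<Longrightarrow> ennreal (T x) \<le>
        (\<integral>\<^sup>+y. ennreal (\<bar>g y\<bar> / y) * indicator (hardy_domain r x) y \<partial>lebesgue_on {0<..})"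
  shows "(\<integral>\<^sup>+x. ennreal (x powr (- r) * T x powr p) \<partial>lebesgue_on {0<..})
    \<le> ennreal ((p / \<bar>r - 1\<bar>) powr p) * (\<integral>\<^sup>+y. ennreal (y powr (- r) * \<bar>g y\<bar> powr p) \<partial>lebesgue_on {0<..})"
proof -
  let ?M = "lebesgue_on {0<..} :: real measure"
  define s where "s = (r - 1) / p"
  \<comment> \<open>The second fact is the sign condition of \<open>nn_integral_hardy_domain\<close>
    for exponent \<open>- s\<close> and reflected parameter \<open>2 - r\<close>.\<close>
  have s: "s \<noteq> 0" "0 < - s * ((2 - r) - 1)"
    using assms(1,2) by (cases "1 < r"; simp add: s_def divide_neg_pos mult_pos_neg mult_neg_pos)+
  \<comment> \<open>\<open>k\<close> holds the domain and the power of \<open>x\<close> left by the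
    pointwise bound; \<open>w\<close> holds the factors free of \<open>x\<close>.\<close>
  define k where "k = (\<lambda>x y. ennreal (x powr (- s - 1)) * indicator (hardy_domain r x) y :: ennreal)"
  define w where "w = (\<lambda>y. \<bar>s\<bar> powr (1 - p) * (y powr (s - r) * \<bar>g y\<bar> powr p))"
  have w_meas [measurable]: "w \<in> borel_measurable ?M"
    unfolding w_def by measurable
  have k_meas [measurable]: "case_prod k \<in> borel_measurable (?M \<Otimes>\<^sub>M ?M)"
  proof -
    \<comment> \<open>As a comparison of coordinates, the indicator is visibly jointly
      measurable.\<close>
    have "case_prod k = (\<lambda>z. ennreal (fst z powr (- s - 1)) *
        (if (if 1 < r then 0 < snd z \<and> snd z < fst z else fst z < snd z) then 1 else 0))"
      by (auto simp: k_def hardy_domain_def indicator_def fun_eq_iff)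
    also have "\<dots> \<in> borel_measurable (?M \<Otimes>\<^sub>M ?M)"
      by measurable
    finally show ?thesis .
  qed
  interpret sigma_finite_measure ?M
    by (rule sigma_finite_lebesgue_on) auto
  interpret P: pair_sigma_finite ?M ?M ..
  have "(\<integral>\<^sup>+x. ennreal (x powr (- r) * T x powr p) \<partial>?M) \<le> (\<integral>\<^sup>+x. \<integral>\<^sup>+y. ennreal (w y) * k x y \<partial>?M \<partial>?M)"
  proof (rule nn_integral_mono)
    fix x assume "x \<in> space ?M"
    then have x: "0 < x" by simp
    let ?J = "\<integral>\<^sup>+y. ennreal (y powr (s - r) * \<bar>g y\<bar> powr p) * indicator (hardy_domain r x) y \<partial>?M"
    have "ennreal (x powr (- r) * T x powr p)
        \<le> ennreal (x powr (- r)) * (ennreal ((x powr s / \<bar>s\<bar>) powr (p - 1)) * ?J)"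
      using hardy_kernel_pointwise[OF assms(1,2) x T(1)[OF x] assms(3) T(2)[OF x]]
      by (auto simp: ennreal_mult' s_def intro!: mult_left_mono)
    also have "\<dots> = ennreal (x powr (- r) * (x powr s / \<bar>s\<bar>) powr (p - 1)) * ?J"
      by (simp add: ennreal_mult' mult.assoc)
    also have "x powr (- r) * (x powr s / \<bar>s\<bar>) powr (p - 1) = x powr (- s - 1) * \<bar>s\<bar> powr (1 - p)"
    proof -
      \<comment> \<open>Again \<open>s * p = r - 1\<close>, so
        \<open>- r + s * (p - 1) = - s - 1\<close>.\<close>
      have "x powr (- r) * x powr (s * (p - 1)) = x powr (- s - 1)"
        using assms(2) by (simp add: powr_add[symmetric] s_def field_simps)
      moreover have "(x powr s / \<bar>s\<bar>) powr (p - 1) = x powr (s * (p - 1)) * \<bar>s\<bar> powr (1 - p)"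
        using x s powr_minus[of "\<bar>s\<bar>" "p - 1"] by (simp add: powr_divide powr_powr field_simps)
      ultimately show ?thesis by simp
    qed
    also have "ennreal (x powr (- s - 1) * \<bar>s\<bar> powr (1 - p)) * ?J = (\<integral>\<^sup>+y. ennreal (w y) * k x y \<partial>?M)"
      by (subst nn_integral_cmult[symmetric], measurable)
        (auto intro!: nn_integral_cong simp: k_def w_def ennreal_mult' mult_ac)
    finally show "ennreal (x powr (- r) * T x powr p) \<le> (\<integral>\<^sup>+y. ennreal (w y) * k x y \<partial>?M)" .
  qed
  also have "\<dots> = (\<integral>\<^sup>+y. \<integral>\<^sup>+x. ennreal (w y) * k x y \<partial>?M \<partial>?M)"
    by (subst P.Fubini') (auto simp: split_beta')
  also have "\<dots> = (\<integral>\<^sup>+y. ennreal ((p / \<bar>r - 1\<bar>) powr p) * ennreal (y powr (- r) * \<bar>g y\<bar> powr p) \<partial>?M)"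
  proof (rule nn_integral_cong)
    fix y assume "y \<in> space ?M"
    then have y: "0 < y" by simp
    have "(\<integral>\<^sup>+x. ennreal (w y) * k x y \<partial>?M) = ennreal (w y) * (\<integral>\<^sup>+x. k x y \<partial>?M)"
      using y by (intro nn_integral_cmult) simp
    also have "(\<integral>\<^sup>+x. k x y \<partial>?M)
        = (\<integral>\<^sup>+x. ennreal (x powr (- s - 1)) * indicator (hardy_domain (2 - r) y) x \<partial>?M)"
      using mem_hardy_domain_dual[OF assms(1) _ y]
      by (intro nn_integral_cong) (auto simp: k_def indicator_def)
    also have "\<dots> = ennreal (y powr (- s) / \<bar>s\<bar>)"
      using nn_integral_hardy_domain[OF y s(2)] by simp
    also have "ennreal (w y) * \<dots> = ennreal (w y * (y powr (- s) / \<bar>s\<bar>))"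
      by (rule ennreal_mult[symmetric]) (simp_all add: w_def)
    also have "w y * (y powr (- s) / \<bar>s\<bar>)
        = (\<bar>s\<bar> powr (1 - p) / \<bar>s\<bar>) * ((y powr (s - r) * y powr (- s)) * \<bar>g y\<bar> powr p)"
      by (simp add: w_def)
    also have "y powr (s - r) * y powr (- s) = y powr (- r)"
      by (simp add: powr_add[symmetric])
    \<comment> \<open>The mass of the inner measure and the integral in \<open>x\<close> together
      contribute \<open>\<bar>s\<bar> powr (- p)\<close>, the sharp constant.\<close>
    also have "\<bar>s\<bar> powr (1 - p) / \<bar>s\<bar> = (p / \<bar>r - 1\<bar>) powr p"
      using assms(1,2) s by (simp add: s_def powr_diff abs_divide powr_divide)
    finally show "(\<integral>\<^sup>+x. ennreal (w y) * k x y \<partial>?M)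
        = ennreal ((p / \<bar>r - 1\<bar>) powr p) * ennreal (y powr (- r) * \<bar>g y\<bar> powr p)"
      by (simp add: ennreal_mult)
  qed
  also have "\<dots> = ennreal ((p / \<bar>r - 1\<bar>) powr p) * (\<integral>\<^sup>+y. ennreal (y powr (- r) * \<bar>g y\<bar> powr p) \<partial>?M)"
    by (rule nn_integral_cmult) measurable
  finally show ?thesis .
qed

section \<open>Weighted norms and extended arithmetic\<close>

lemma measurable_weighted_measure [simp]:
  "borel_measurable (weighted_measure r) = borel_measurable (lebesgue_on {0<..})"
  unfolding weighted_measure_def by (rule measurable_cong_sets) auto

lemma nn_integral_weighted_measure:
  assumes [measurable]: "h \<in> borel_measurable (lebesgue_on {0<..})"
  shows "(\<integral>\<^sup>+x. ennreal (\<bar>h x\<bar> powr p) \<partial>weighted_measure r)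
    = (\<integral>\<^sup>+x. ennreal (x powr (- r) * \<bar>h x\<bar> powr p) \<partial>lebesgue_on {0<..})"
  unfolding weighted_measure_def
  by (subst nn_integral_density, measurable) (auto intro!: nn_integral_cong simp: ennreal_mult)

text \<open>Turns a bound between integrals of \<open>p\<close>-th powers into one between norms.
  For infinite \<open>b\<close> the right side is infinite because \<open>c\<close> is positive; for
  finite \<open>b\<close> also \<open>a\<close> is finite.\<close>

lemma ennreal_powr_le_cmult:
  assumes "a \<le> ennreal (c powr p) * b" "0 < c" "0 < p"
  shows "ennreal_powr a (1 / p) \<le> ennreal c * ennreal_powr b (1 / p)"
proof (cases b)
  case (real v)
  then have "a \<le> ennreal (c powr p * v)"
    using assms by (simp add: ennreal_mult)
  moreover from this obtain u where u: "a = ennreal u" "0 \<le> u"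
    by (cases a) (auto simp: top_unique)
  ultimately have "u \<le> c powr p * v"
    using real by (simp add: ennreal_le_iff)
  then have "u powr (1 / p) \<le> (c powr p * v) powr (1 / p)"
    using u assms by (intro powr_mono2) auto
  also have "\<dots> = c * v powr (1 / p)"
    using assms real by (simp add: powr_mult powr_powr)
  finally show ?thesis
    using u real assms by (simp add: ennreal_powr_def ennreal_leI flip: ennreal_mult)
qed (use assms in \<open>auto simp: ennreal_powr_def ennreal_mult_top\<close>)

lemma ennreal_powr_less_top_iff: "ennreal_powr a s < top \<longleftrightarrow> a < top"
  by (auto simp: ennreal_powr_def less_top)

text \<open>Discards a denominator of at most 1 in the final lower bound. For \<open>b = 0\<close>
  the quotient is \<open>top\<close>, or 0 when \<open>a = 0\<close>.\<close>

lemma ennreal_le_divide: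
  fixes a b :: ennreal
  assumes "b \<le> 1"
  shows "a \<le> a / b"
proof -
  obtain t where t: "b = ennreal t" "0 \<le> t" "t \<le> 1"
    using assms by (cases b) (auto simp: top_unique)
  show ?thesis
  proof (cases "t = 0")
    case False
    then have "u \<le> u / t" if "0 \<le> u" for u
      using t that by (simp add: field_simps mult_left_le_one_le)
    then show ?thesis
      using t False by (cases a) (auto simp: ennreal_top_divide divide_ennreal ennreal_leI)
  qed (simp add: t)
qed

section \<open>Integrability and measurability of the Hardy operator\<close>

text \<open>If the integral were infinite, \<open>hardy_kernel_pointwise\<close> would hold for
  every \<open>A\<close> with one finite right side \<open>B\<close>. The choice
  \<open>A = B + 1\<close> refutes this.\<close>

lemma finite_kernel_integral:
  assumes "r \<noteq> 1" "1 < p" "0 < x" and [measurable]: "g \<in> borel_measurable (lebesgue_on {0<..})"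
    and fin: "weighted_norm p r g < \<infinity>"
  shows "(\<integral>\<^sup>+y. ennreal (\<bar>g y\<bar> / y) * indicator (hardy_domain r x) y \<partial>lebesgue_on {0<..}) < \<infinity>"
proof (rule ccontr)
  let ?M = "lebesgue_on {0<..} :: real measure"
  assume "\<not> ?thesis"
  then have inf: "(\<integral>\<^sup>+y. ennreal (\<bar>g y\<bar> / y) * indicator (hardy_domain r x) y \<partial>?M) = \<infinity>"
    by (simp flip: less_top)
  define s where "s = (r - 1) / p"
  have "(\<integral>\<^sup>+y. ennreal (y powr (s - r) * \<bar>g y\<bar> powr p) * indicator (hardy_domain r x) y \<partial>?M)
      \<le> (\<integral>\<^sup>+y. ennreal (x powr s) * ennreal (y powr (- r) * \<bar>g y\<bar> powr p) \<partial>?M)"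
  proof (rule nn_integral_mono)
    fix y assume "y \<in> space ?M"
    then have y: "0 < y" by simp
    have "y powr (s - r) * \<bar>g y\<bar> powr p \<le> x powr s * (y powr (- r) * \<bar>g y\<bar> powr p)"
      if "y \<in> hardy_domain r x"
    proof -
      \<comment> \<open>Either \<open>s > 0\<close> and \<open>y < x\<close>, or
        \<open>s < 0\<close> and \<open>y > x\<close>.\<close>
      have "y powr s \<le> x powr s"
      proof (cases "1 < r")
        case True
        then show ?thesis
          using that assms(2) by (intro powr_mono2) (auto simp: s_def hardy_domain_def)
      next
        case False
        then show ?thesis
          using that assms by (intro powr_mono2') (auto simp: s_def hardy_domain_def divide_simps)
      qed
      then have "y powr s * (y powr (- r) * \<bar>g y\<bar> powr p) \<le> x powr s * (y powr (- r) * \<bar>g y\<bar> powr p)"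
        by (intro mult_right_mono) auto
      then show ?thesis
        using y by (simp add: powr_diff powr_minus field_simps)
    qed
    then show "ennreal (y powr (s - r) * \<bar>g y\<bar> powr p) * indicator (hardy_domain r x) y
        \<le> ennreal (x powr s) * ennreal (y powr (- r) * \<bar>g y\<bar> powr p)"
      by (auto simp: indicator_def ennreal_leI simp flip: ennreal_mult)
  qed
  also have "\<dots> = ennreal (x powr s) * (\<integral>\<^sup>+y. ennreal (y powr (- r) * \<bar>g y\<bar> powr p) \<partial>?M)"
    by (rule nn_integral_cmult) measurable
  also have "\<dots> < \<infinity>"
    using fin by (simp add: weighted_norm_def ennreal_powr_less_top_iff nn_integral_weighted_measure
        ennreal_mult_less_top)
  finally have "ennreal ((x powr s / \<bar>s\<bar>) powr (p - 1)) *
      (\<integral>\<^sup>+y. ennreal (y powr (s - r) * \<bar>g y\<bar> powr p) * indicator (hardy_domain r x) y \<partial>?M) < \<infinity>"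
    by (simp add: ennreal_mult_less_top)
  then obtain B where B: "0 \<le> B" "ennreal ((x powr s / \<bar>s\<bar>) powr (p - 1)) *
      (\<integral>\<^sup>+y. ennreal (y powr (s - r) * \<bar>g y\<bar> powr p) * indicator (hardy_domain r x) y \<partial>?M) = ennreal B"
    by (auto simp: less_top_ennreal)
  have "ennreal ((B + 1) powr p) \<le> ennreal B"
    using hardy_kernel_pointwise[of r p x "B + 1" g] assms B inf by (simp add: s_def)
  then have "(B + 1) powr p \<le> B"
    using B by simp
  moreover have "(B + 1) powr 1 \<le> (B + 1) powr p"
    using B assms by (intro powr_mono) auto
  ultimately show False
    using B by simp
qed

lemma set_integrable_hardy:
  assumes "r \<noteq> 1" "1 < p" "0 < x" and g [measurable]: "g \<in> borel_measurable (lebesgue_on {0<..})"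
    and fin: "weighted_norm p r g < \<infinity>"
  shows "set_integrable lebesgue (hardy_domain r x) (\<lambda>y. inverse y * g y)"
proof -
  have D: "hardy_domain r x \<subseteq> {0<..}" "hardy_domain r x \<in> sets lebesgue"
    using hardy_domain_subset[OF assms(3)] by auto
  have "set_integrable (lebesgue_on {0<..}) (hardy_domain r x) (\<lambda>y. inverse y * g y)"
    unfolding set_integrable_def
  proof (rule integrableI_bounded)
    have "(\<integral>\<^sup>+y. ennreal (norm (indicat_real (hardy_domain r x) y *\<^sub>R (inverse y * g y))) \<partial>lebesgue_on {0<..})
        = (\<integral>\<^sup>+y. ennreal (\<bar>g y\<bar> / y) * indicator (hardy_domain r x) y \<partial>lebesgue_on {0<..})"
      by (intro nn_integral_cong) (auto simp: indicator_def abs_mult divide_simps)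
    also have "\<dots> < \<infinity>"
      by (rule finite_kernel_integral[OF assms])
    finally show "(\<integral>\<^sup>+y. ennreal (norm (indicat_real (hardy_domain r x) y *\<^sub>R (inverse y * g y)))
        \<partial>lebesgue_on {0<..}) < \<infinity>" .
  qed measurable
  then have "integrable lebesgue (\<lambda>y. indicator {0<..} y *\<^sub>R
      (indicat_real (hardy_domain r x) y *\<^sub>R (inverse y * g y)))"
    unfolding set_integrable_def by (subst (asm) integrable_restrict_space) auto
  also have "(\<lambda>y. indicator {0<..} y *\<^sub>R (indicat_real (hardy_domain r x) y *\<^sub>R (inverse y * g y)))
      = (\<lambda>y. indicat_real (hardy_domain r x) y *\<^sub>R (inverse y * g y))"
    using D by (auto simp: indicator_def fun_eq_iff)
  finally show ?thesis
    by (simp add: set_integrable_def)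
qed

text \<open>Moves the dependence on \<open>x\<close> from the domain into the integrand, as required
  for measurability in the parameter \<open>x\<close>.\<close>

lemma hardy_op_eq_integral:
  assumes "0 < x"
  shows "hardy_op r g x = (LINT y|lebesgue_on {0<..}. indicator (hardy_domain r x) y * (inverse y * g y))"
proof -
  have "(LINT y|lebesgue_on {0<..}. indicator (hardy_domain r x) y * (inverse y * g y))
      = (LINT y|lebesgue. indicator {0<..} y *\<^sub>R (indicator (hardy_domain r x) y * (inverse y * g y)))"
    by (rule integral_restrict_space) simp
  also have "\<dots> = hardy_op r g x"
    unfolding hardy_op_def set_lebesgue_integral_def
    using hardy_domain_subset[OF assms, of r] by (intro Bochner_Integration.integral_cong) (auto simp: indicator_def)
  finally show ?thesis ..
qed

lemma hardy_op_measurable [measurable]: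
  assumes [measurable]: "g \<in> borel_measurable (lebesgue_on {0<..})"
  shows "hardy_op r g \<in> borel_measurable (lebesgue_on {0<..})"
proof -
  let ?M = "lebesgue_on {0<..} :: real measure"
  interpret sigma_finite_measure ?M
    by (rule sigma_finite_lebesgue_on) auto
  have "(\<lambda>(x, y). indicator (hardy_domain r x) y * (inverse y * g y))
      = (\<lambda>z. (if (if 1 < r then 0 < snd z \<and> snd z < fst z else fst z < snd z) then 1 else 0)
          * (inverse (snd z) * g (snd z)))"
    by (auto simp: hardy_domain_def indicator_def fun_eq_iff)
  also have "\<dots> \<in> borel_measurable (?M \<Otimes>\<^sub>M ?M)"
    by measurable
  finally have "(\<lambda>x. LINT y|?M. indicator (hardy_domain r x) y * (inverse y * g y)) \<in> borel_measurable ?M"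
    by (rule borel_measurable_lebesgue_integral)
  then show ?thesis
    by (rule measurable_cong[THEN iffD2, rotated]) (simp add: hardy_op_eq_integral)
qed

lemma abs_hardy_op_le:
  assumes "0 < x" and [measurable]: "g \<in> borel_measurable (lebesgue_on {0<..})"
  shows "ennreal \<bar>hardy_op r g x\<bar>
    \<le> (\<integral>\<^sup>+y. ennreal (\<bar>g y\<bar> / y) * indicator (hardy_domain r x) y \<partial>lebesgue_on {0<..})"
proof -
  have "ennreal \<bar>hardy_op r g x\<bar>
      \<le> (\<integral>\<^sup>+y. ennreal (norm (indicator (hardy_domain r x) y * (inverse y * g y))) \<partial>lebesgue_on {0<..})"
  proof (cases "integrable (lebesgue_on {0<..}) (\<lambda>y. indicator (hardy_domain r x) y * (inverse y * g y))")
    case True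
    then show ?thesis
      unfolding hardy_op_eq_integral[OF assms(1)] real_norm_def[symmetric]
      by (rule integral_norm_bound_ennreal)
  next
    \<comment> \<open>The Bochner integral is then 0 by convention, so the bound is trivial.\<close>
    case False
    then show ?thesis
      by (simp add: hardy_op_eq_integral[OF assms(1)] not_integrable_integral_eq)
  qed
  also have "\<dots> = (\<integral>\<^sup>+y. ennreal (\<bar>g y\<bar> / y) * indicator (hardy_domain r x) y \<partial>lebesgue_on {0<..})"
    by (intro nn_integral_cong) (auto simp: indicator_def abs_mult divide_simps)
  finally show ?thesis .
qed

section \<open>The upper bound for single exponents and for grand norms\<close>

lemma hardy_inequality:
  assumes "r \<noteq> 1" "1 < p" and [measurable]: "g \<in> borel_measurable (lebesgue_on {0<..})"
  shows "weighted_norm p r (hardy_op r g) \<le> ennreal (p / \<bar>r - 1\<bar>) * weighted_norm p r g"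
  unfolding weighted_norm_def
proof (rule ennreal_powr_le_cmult)
  show "(\<integral>\<^sup>+x. ennreal (\<bar>hardy_op r g x\<bar> powr p) \<partial>weighted_measure r)
      \<le> ennreal ((p / \<bar>r - 1\<bar>) powr p) * (\<integral>\<^sup>+x. ennreal (\<bar>g x\<bar> powr p) \<partial>weighted_measure r)"
    using nn_integral_hardy[OF assms, of "\<lambda>x. \<bar>hardy_op r g x\<bar>"] abs_hardy_op_le[OF _ assms(3)]
    by (simp add: nn_integral_weighted_measure)
qed (use assms in auto)

lemma weighted_norm_le_grand_norm:
  assumes "1 < p" "0 < \<psi> p"
  shows "weighted_norm p r g \<le> ennreal (\<psi> p) * grand_norm r \<psi> g"
proof -
  have "weighted_norm p r g = ennreal (\<psi> p) * (weighted_norm p r g / ennreal (\<psi> p))"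
    using assms by (simp add: ennreal_times_divide mult.commute[of "ennreal _"] mult_divide_eq_ennreal)
  also have "\<dots> \<le> ennreal (\<psi> p) * grand_norm r \<psi> g"
    unfolding grand_norm_def using assms by (intro mult_left_mono SUP_upper) auto
  finally show ?thesis .
qed

lemma grand_norm_hardy_op_le:
  assumes "r \<noteq> 1" "\<And>p. 1 < p \<Longrightarrow> 0 < \<psi> p" "g \<in> borel_measurable (lebesgue_on {0<..})"
  shows "grand_norm r (\<lambda>p. p * \<psi> p) (hardy_op r g) \<le> ennreal (1 / \<bar>r - 1\<bar>) * grand_norm r \<psi> g"
  unfolding grand_norm_def[of r "\<lambda>p. p * \<psi> p"]
proof (rule SUP_least, rule divide_le_posI_ennreal)
  fix p :: real assume p: "p \<in> {1<..}"
  then show "0 < ennreal (p * \<psi> p)"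
    using assms(2)[of p] by simp
  have "weighted_norm p r (hardy_op r g) \<le> ennreal (p / \<bar>r - 1\<bar>) * weighted_norm p r g"
    using hardy_inequality assms p by simp
  also have "\<dots> \<le> ennreal (p / \<bar>r - 1\<bar>) * (ennreal (\<psi> p) * grand_norm r \<psi> g)"
    using weighted_norm_le_grand_norm[of p \<psi>] assms p by (intro mult_left_mono) auto
  also have "\<dots> = ennreal (p * \<psi> p) * (ennreal (1 / \<bar>r - 1\<bar>) * grand_norm r \<psi> g)"
    using assms(2)[of p] p by (simp add: mult.assoc[symmetric] flip: ennreal_mult)
  finally show "weighted_norm p r (hardy_op r g)
      \<le> ennreal (p * \<psi> p) * (ennreal (1 / \<bar>r - 1\<bar>) * grand_norm r \<psi> g)" .
qed

section \<open>The extremal function\<close>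

text \<open>The power is critical for \<open>p = 1\<close>: the weighted \<open>p\<close>-th power
  is integrable for each \<open>p > 1\<close>, but becomes \<open>1 / x\<close> at
  \<open>p = 1\<close>. The cut-off keeps only the end where the integral converges for
  \<open>p > 1\<close>.\<close>

definition hardy_extremal :: "real \<Rightarrow> real \<Rightarrow> real" where
  "hardy_extremal r x = indicator (hardy_domain r 1) x * x powr (r - 1)"

lemma hardy_extremal_measurable [measurable]: "hardy_extremal r \<in> borel_measurable (lebesgue_on S)"
  unfolding hardy_extremal_def[abs_def] by measurable

lemma weighted_norm_hardy_extremal:
  assumes "r \<noteq> 1" "1 < p"
  shows "weighted_norm p r (hardy_extremal r) = ennreal ((\<bar>r - 1\<bar> * (p - 1)) powr (- 1 / p))"
proof -
  \<comment> \<open>\<open>u - 1\<close> is the exponent of the weighted \<open>p\<close>-th power,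
    and \<open>u\<close> has the sign of \<open>r - 1\<close>.\<close>
  define u where "u = (r - 1) * (p - 1)"
  have u: "0 < u * (r - 1)"
    using assms by (cases "1 < r") (auto simp: u_def mult_neg_pos mult_neg_neg)
  have "(\<integral>\<^sup>+x. ennreal (\<bar>hardy_extremal r x\<bar> powr p) \<partial>weighted_measure r)
      = (\<integral>\<^sup>+x. ennreal (x powr (u - 1)) * indicator (hardy_domain r 1) x \<partial>lebesgue_on {0<..})"
    unfolding nn_integral_weighted_measure[OF hardy_extremal_measurable]
  proof (rule nn_integral_cong)
    fix x :: real
    have "x powr (- r) * (x powr (r - 1)) powr p = x powr (u - 1)"
      by (simp add: powr_powr powr_add[symmetric] u_def algebra_simps)
    then show "ennreal (x powr (- r) * \<bar>hardy_extremal r x\<bar> powr p)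
        = ennreal (x powr (u - 1)) * indicator (hardy_domain r 1) x"
      using assms by (simp add: hardy_extremal_def indicator_def)
  qed
  also have "\<dots> = ennreal (1 / (\<bar>r - 1\<bar> * (p - 1)))"
    using nn_integral_hardy_domain[OF _ u, of 1] assms by (simp add: u_def abs_mult)
  finally have "weighted_norm p r (hardy_extremal r) = ennreal ((1 / (\<bar>r - 1\<bar> * (p - 1))) powr (1 / p))"
    using assms by (simp add: weighted_norm_def ennreal_powr_def)
  also have "(1 / (\<bar>r - 1\<bar> * (p - 1))) powr (1 / p) = (\<bar>r - 1\<bar> * (p - 1)) powr (- 1 / p)"
    using assms by (simp add: powr_divide powr_minus_divide)
  finally show ?thesis .
qed

text \<open>For such \<open>x\<close>, \<open>hardy_domain r x\<close> lies inside
  \<open>hardy_domain r 1\<close>, so the cut-off is invisible and a pure power is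
  integrated.\<close>

lemma hardy_op_extremal:
  assumes "r \<noteq> 1" "0 < x" "x \<in> hardy_domain r 1"
  shows "hardy_op r (hardy_extremal r) x = hardy_extremal r x / \<bar>r - 1\<bar>"
proof -
  have "indicator (hardy_domain r x) y * (inverse y * hardy_extremal r y)
      = y powr ((r - 1) - 1) * indicator (hardy_domain r x) y" if "0 < y" for y
  proof -
    have "y powr (r - 1) = y * y powr (r - 2)"
      using that by (simp add: powr_mult_base)
    then show ?thesis
      using assms that by (auto simp: hardy_extremal_def indicator_def hardy_domain_def split: if_splits)
  qed
  then have "hardy_op r (hardy_extremal r) x
      = (LINT y|lebesgue_on {0<..}. y powr ((r - 1) - 1) * indicator (hardy_domain r x) y)"
    unfolding hardy_op_eq_integral[OF assms(2)] by (intro Bochner_Integration.integral_cong) auto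
  also have "\<dots> = enn2real (\<integral>\<^sup>+y. ennreal (y powr ((r - 1) - 1) * indicator (hardy_domain r x) y)
      \<partial>lebesgue_on {0<..})"
    by (rule integral_eq_nn_integral) auto
  also have "\<dots> = x powr (r - 1) / \<bar>r - 1\<bar>"
    using nn_integral_hardy_domain[of x "r - 1" r] assms not_real_square_gt_zero[of "r - 1"]
    by (simp add: ennreal_mult' ennreal_indicator del: not_real_square_gt_zero)
  finally show ?thesis
    using assms by (simp add: hardy_extremal_def)
qed

text \<open>Pointwise comparison: equality on \<open>hardy_domain r 1\<close> by
  \<open>hardy_op_extremal\<close>, and outside it \<open>hardy_extremal r\<close> vanishes.\<close>

lemma weighted_norm_hardy_op_extremal_ge:
  assumes "r \<noteq> 1" "1 < p"
  shows "weighted_norm p r (hardy_extremal r)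
    \<le> ennreal \<bar>r - 1\<bar> * weighted_norm p r (hardy_op r (hardy_extremal r))"
  unfolding weighted_norm_def
proof (rule ennreal_powr_le_cmult)
  let ?M = "lebesgue_on {0<..} :: real measure" and ?g = "hardy_extremal r"
  have "(\<integral>\<^sup>+x. ennreal (x powr (- r) * \<bar>?g x\<bar> powr p) \<partial>?M)
      \<le> (\<integral>\<^sup>+x. ennreal (\<bar>r - 1\<bar> powr p) * ennreal (x powr (- r) * \<bar>hardy_op r ?g x\<bar> powr p) \<partial>?M)"
  proof (rule nn_integral_mono)
    fix x assume "x \<in> space ?M"
    then have x: "0 < x" by simp
    have "\<bar>?g x\<bar> powr p \<le> \<bar>r - 1\<bar> powr p * \<bar>hardy_op r ?g x\<bar> powr p"
    proof (cases "x \<in> hardy_domain r 1")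
      case True
      then show ?thesis
        using hardy_op_extremal[OF assms(1) x True] assms
        by (simp add: abs_divide powr_divide)
    qed (use assms in \<open>simp add: hardy_extremal_def\<close>)
    then have "x powr (- r) * \<bar>?g x\<bar> powr p
        \<le> x powr (- r) * (\<bar>r - 1\<bar> powr p * \<bar>hardy_op r ?g x\<bar> powr p)"
      by (rule mult_left_mono) simp
    also have "\<dots> = \<bar>r - 1\<bar> powr p * (x powr (- r) * \<bar>hardy_op r ?g x\<bar> powr p)"
      by simp
    finally have "x powr (- r) * \<bar>?g x\<bar> powr p
        \<le> \<bar>r - 1\<bar> powr p * (x powr (- r) * \<bar>hardy_op r ?g x\<bar> powr p)" .
    then show "ennreal (x powr (- r) * \<bar>?g x\<bar> powr p)
        \<le> ennreal (\<bar>r - 1\<bar> powr p) * ennreal (x powr (- r) * \<bar>hardy_op r ?g x\<bar> powr p)"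
      by (auto intro!: ennreal_leI simp flip: ennreal_mult)
  qed
  also have "\<dots> = ennreal (\<bar>r - 1\<bar> powr p) * (\<integral>\<^sup>+x. ennreal (x powr (- r) * \<bar>hardy_op r ?g x\<bar> powr p) \<partial>?M)"
    by (rule nn_integral_cmult) measurable
  finally show "(\<integral>\<^sup>+x. ennreal (\<bar>?g x\<bar> powr p) \<partial>weighted_measure r)
      \<le> ennreal (\<bar>r - 1\<bar> powr p) * (\<integral>\<^sup>+x. ennreal (\<bar>hardy_op r ?g x\<bar> powr p) \<partial>weighted_measure r)"
    by (simp add: nn_integral_weighted_measure)
qed (use assms in auto)

text \<open>Admits the function to the supremum over nonzero \<open>g\<close>. Its norm for
  \<open>p = 2\<close> is \<open>\<bar>r - 1\<bar> powr (- 1 / 2)\<close>, which is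
  positive.\<close>

lemma hardy_extremal_not_AE_0:
  assumes "r \<noteq> 1"
  shows "\<not> (AE x in weighted_measure r. hardy_extremal r x = 0)"
proof
  assume "AE x in weighted_measure r. hardy_extremal r x = 0"
  then have "(\<integral>\<^sup>+x. ennreal (\<bar>hardy_extremal r x\<bar> powr 2) \<partial>weighted_measure r)
      = (\<integral>\<^sup>+x. 0 \<partial>weighted_measure r)"
    by (intro nn_integral_cong_AE) auto
  then have "weighted_norm 2 r (hardy_extremal r) = 0"
    by (simp add: weighted_norm_def ennreal_powr_def)
  then show False
    using assms by (simp add: weighted_norm_hardy_extremal)
qed

section \<open>The extremal weight and sharpness of the constant\<close>

text \<open>
  By \<open>weighted_norm_hardy_extremal\<close> the second argument of \<open>max\<close> is the norm of
  \<open>hardy_extremal r\<close>, which tends to \<open>\<infinity>\<close> as \<open>p \<rightarrow> 1\<close>; the maximum with \<open>1\<close> keeps the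
  infimum positive.
\<close>

definition extremal_Psi :: "real \<Rightarrow> real \<Rightarrow> real" where
  "extremal_Psi r p = max 1 ((\<bar>r - 1\<bar> * (p - 1)) powr (- 1 / p))"

lemma extremal_Psi_in_class:
  assumes "r \<noteq> 1"
  shows "extremal_Psi r \<in> Psi_class"
proof -
  define c where "c = \<bar>r - 1\<bar>"
  have c: "0 < c" using assms by (simp add: c_def)
  have eq: "extremal_Psi r = (\<lambda>p. max 1 ((c * (p - 1)) powr (- 1 / p)))"
    by (simp add: fun_eq_iff extremal_Psi_def c_def)
  \<comment> \<open>The base tends to 0 from above and the exponent to -1.\<close>
  have "filterlim (\<lambda>p. (c * (p - 1)) powr (- 1 / p)) at_top (at_right 1)"
    using c by real_asymp
  then have "filterlim (extremal_Psi r) at_top (at_right 1)"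
    by (rule filterlim_at_top_mono) (simp add: eq)
  then have 1: "((\<lambda>p. ereal (extremal_Psi r p)) \<longlongrightarrow> \<infinity>) (at_right 1)"
    by (simp add: tendsto_PInfty_eq_at_top)
  \<comment> \<open>The logarithm is of order \<open>ln p / p\<close>, which tends to 0.\<close>
  have "((\<lambda>p. (c * (p - 1)) powr (- 1 / p)) \<longlongrightarrow> 1) at_top"
    using c by real_asymp
  then have "((\<lambda>p. max 1 ((c * (p - 1)) powr (- 1 / p))) \<longlongrightarrow> max 1 1) at_top"
    by (intro tendsto_intros)
  then have 2: "((\<lambda>p. ereal (extremal_Psi r p)) \<longlongrightarrow> ereal 1) at_top"
    by (simp add: eq del: ereal_max)
  have 3: "continuous_on {1<..} (extremal_Psi r)"
    unfolding eq using c by (intro continuous_intros) auto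
  have "1 \<le> (INF p\<in>{1<..}. extremal_Psi r p)"
    by (rule cINF_greatest) (auto simp: eq intro: exI[of _ 2])
  then have 4: "0 < (INF p\<in>{1<..}. extremal_Psi r p)"
    by linarith
  have 5: "0 < extremal_Psi r p" for p
    by (simp add: eq less_max_iff_disj)
  show ?thesis
    unfolding Psi_class_def mem_Collect_eq
  proof (intro conjI)
    show "\<exists>L. ((\<lambda>p. ereal (extremal_Psi r p)) \<longlongrightarrow> L) (at_right 1) \<and> 0 < L"
      using 1 by (intro exI[of _ \<infinity>]) simp
    show "\<exists>L. ((\<lambda>p. ereal (extremal_Psi r p)) \<longlongrightarrow> L) at_top \<and> 0 < L"
      using 2 by (intro exI[of _ "ereal 1"]) simp
  qed (use 3 4 5 in auto)
qed

lemma grand_norm_hardy_extremal_le: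
  assumes "r \<noteq> 1"
  shows "grand_norm r (extremal_Psi r) (hardy_extremal r) \<le> 1"
  unfolding grand_norm_def
  using assms by (intro SUP_least divide_le_posI_ennreal)
    (auto simp: weighted_norm_hardy_extremal extremal_Psi_def less_max_iff_disj intro!: ennreal_leI)

text \<open>Near \<open>p = 1\<close> the weight equals the norm of \<open>hardy_extremal r\<close>,
  so the quotient at \<open>p\<close> is at least \<open>1 / (p * \<bar>r - 1\<bar>)\<close>.
  Letting \<open>p\<close> tend to 1 removes the factor \<open>p\<close>.\<close>

lemma grand_norm_hardy_op_extremal_ge:
  assumes "r \<noteq> 1"
  shows "ennreal (1 / \<bar>r - 1\<bar>) \<le> grand_norm r (\<lambda>p. p * extremal_Psi r p) (hardy_op r (hardy_extremal r))"
    (is "_ \<le> ?G")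
proof (rule tendsto_upperbound)
  define c where "c = \<bar>r - 1\<bar>"
  have c: "0 < c" using assms by (simp add: c_def)
  have "((\<lambda>p. 1 / (p * c)) \<longlongrightarrow> 1 / c) (at_right 1)"
    using c by (auto intro!: tendsto_eq_intros)
  then show "((\<lambda>p. ennreal (1 / (p * \<bar>r - 1\<bar>))) \<longlongrightarrow> ennreal (1 / \<bar>r - 1\<bar>)) (at_right 1)"
    unfolding c_def by (rule tendsto_ennrealI)
  \<comment> \<open>The bound \<open>p < 1 + 1 / c\<close> means \<open>c * (p - 1) < 1\<close>,
    which makes \<open>v\<close> the larger argument of \<open>max\<close>.\<close>
  have "ennreal (1 / (p * c)) \<le> ?G" if p: "1 < p" "p < 1 + 1 / c" for p
  proof -
    define v where "v = (c * (p - 1)) powr (- 1 / p)"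
    have "c * (p - 1) \<le> 1" "0 < c * (p - 1)"
      using p c by (auto simp: field_simps)
    then have "1 \<le> v"
      using powr_mono2'[of "- 1 / p" "c * (p - 1)" 1] p by (simp add: v_def)
    then have \<psi>: "extremal_Psi r p = v"
      by (simp add: extremal_Psi_def v_def c_def)
    have "ennreal v \<le> ennreal c * weighted_norm p r (hardy_op r (hardy_extremal r))"
      using weighted_norm_hardy_op_extremal_ge[OF assms p(1)] assms p
      by (simp add: weighted_norm_hardy_extremal v_def c_def)
    also have "\<dots> \<le> ennreal c * (ennreal (p * v) * ?G)"
      using weighted_norm_le_grand_norm[of p "\<lambda>p. p * extremal_Psi r p"] p \<open>1 \<le> v\<close>
      by (intro mult_left_mono) (auto simp: \<psi>)
    also have "\<dots> = ennreal (c * (p * v)) * ?G"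
      using p c \<open>1 \<le> v\<close> by (simp add: ennreal_mult mult.assoc)
    also have "c * (p * v) = p * c * v"
      by simp
    \<comment> \<open>A finite positive factor cancels \<open>v\<close> even if \<open>?G\<close> is
      infinite.\<close>
    finally have "ennreal (1 / (p * c * v)) * ennreal v \<le> ennreal (1 / (p * c * v)) * (ennreal (p * c * v) * ?G)"
      by (rule mult_left_mono) simp
    then show ?thesis
      using p c \<open>1 \<le> v\<close> by (simp add: mult.assoc[symmetric] flip: ennreal_mult)
  qed
  then show "\<forall>\<^sub>F p in at_right 1. ennreal (1 / (p * \<bar>r - 1\<bar>)) \<le> ?G"
    unfolding eventually_at_right_field c_def[symmetric]
    using c by (intro exI[of _ "1 + 1 / c"]) auto
qed simp

theorem theorem9:
  fixes r :: real
  assumes "r > 0" and "r \<noteq> 1"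
  shows "(\<forall>\<psi>\<in>Psi_class. \<forall>g\<in>grand_space r \<psi>.
            (\<forall>x>0. set_integrable lebesgue (hardy_domain r x) (\<lambda>y. inverse y * g y)) \<and>
            hardy_op r g \<in> grand_space r (\<lambda>p. p * \<psi> p) \<and>
            grand_norm r (\<lambda>p. p * \<psi> p) (hardy_op r g)
              \<le> ennreal (1 / \<bar>r - 1\<bar>) * grand_norm r \<psi> g) \<and>
         (SUP \<psi>\<in>Psi_class. SUP g\<in>{g \<in> grand_space r \<psi>. \<not> (AE x in weighted_measure r. g x = 0)}.
            grand_norm r (\<lambda>p. p * \<psi> p) (hardy_op r g) / grand_norm r \<psi> g)
           = ennreal (1 / \<bar>r - 1\<bar>)"
proof -
  have le: "grand_norm r (\<lambda>p. p * \<psi> p) (hardy_op r g) \<le> ennreal (1 / \<bar>r - 1\<bar>) * grand_norm r \<psi> g"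
    if "\<psi> \<in> Psi_class" "g \<in> grand_space r \<psi>" for \<psi> g
    using that assms by (intro grand_norm_hardy_op_le) (auto simp: Psi_class_def grand_space_def)
  have "set_integrable lebesgue (hardy_domain r x) (\<lambda>y. inverse y * g y)"
    if "\<psi> \<in> Psi_class" "g \<in> grand_space r \<psi>" "0 < x" for \<psi> g x
  \<comment> \<open>Any exponent above 1 would do, since a finite grand norm bounds every weighted
    norm.\<close>
  proof (rule set_integrable_hardy[where p = 2])
    have "weighted_norm 2 r g \<le> ennreal (\<psi> 2) * grand_norm r \<psi> g"
      using that by (intro weighted_norm_le_grand_norm) (auto simp: Psi_class_def)
    also have "\<dots> < \<infinity>"
      using that by (auto simp: grand_space_def ennreal_mult_less_top)
    finally show "weighted_norm 2 r g < \<infinity>" .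
  qed (use that assms in \<open>auto simp: grand_space_def\<close>)
  moreover have "hardy_op r g \<in> grand_space r (\<lambda>p. p * \<psi> p)"
    if "\<psi> \<in> Psi_class" "g \<in> grand_space r \<psi>" for \<psi> g
    using le[OF that] that
    by (auto simp: grand_space_def ennreal_mult_less_top intro!: hardy_op_measurable elim!: le_less_trans)
  moreover have "(SUP \<psi>\<in>Psi_class. SUP g\<in>{g \<in> grand_space r \<psi>. \<not> (AE x in weighted_measure r. g x = 0)}.
      grand_norm r (\<lambda>p. p * \<psi> p) (hardy_op r g) / grand_norm r \<psi> g) = ennreal (1 / \<bar>r - 1\<bar>)"
  proof (rule antisym)
    have "grand_norm r (\<lambda>p. p * \<psi> p) (hardy_op r g) / grand_norm r \<psi> g \<le> ennreal (1 / \<bar>r - 1\<bar>)"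
      if "\<psi> \<in> Psi_class" "g \<in> grand_space r \<psi>" for \<psi> g
    \<comment> \<open>A zero denominator forces a zero numerator by \<open>le\<close>, and
      \<open>0 / 0 = 0\<close> in \<open>ennreal\<close>.\<close>
    proof (cases "grand_norm r \<psi> g = 0")
      case True
      then show ?thesis
        using le[OF that] by simp
    next
      case False
      then show ?thesis
        using le[OF that] by (intro divide_le_posI_ennreal) (auto simp: mult.commute zero_less_iff_neq_zero)
    qed
    then show "(SUP \<psi>\<in>Psi_class. SUP g\<in>{g \<in> grand_space r \<psi>. \<not> (AE x in weighted_measure r. g x = 0)}.
        grand_norm r (\<lambda>p. p * \<psi> p) (hardy_op r g) / grand_norm r \<psi> g) \<le> ennreal (1 / \<bar>r - 1\<bar>)"
      by (intro SUP_least) auto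
  next
    let ?\<psi> = "extremal_Psi r" and ?g = "hardy_extremal r"
    have g: "?g \<in> grand_space r ?\<psi>"
      using grand_norm_hardy_extremal_le[OF assms(2)]
      by (auto simp: grand_space_def less_top[symmetric] top_unique)
    have "ennreal (1 / \<bar>r - 1\<bar>) \<le> grand_norm r (\<lambda>p. p * ?\<psi> p) (hardy_op r ?g)"
      by (rule grand_norm_hardy_op_extremal_ge[OF assms(2)])
    also have "\<dots> \<le> grand_norm r (\<lambda>p. p * ?\<psi> p) (hardy_op r ?g) / grand_norm r ?\<psi> ?g"
      using grand_norm_hardy_extremal_le[OF assms(2)] by (rule ennreal_le_divide)
    also have "\<dots> \<le> (SUP \<psi>\<in>Psi_class. SUP g\<in>{g \<in> grand_space r \<psi>. \<not> (AE x in weighted_measure r. g x = 0)}.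
        grand_norm r (\<lambda>p. p * \<psi> p) (hardy_op r g) / grand_norm r \<psi> g)"
      using extremal_Psi_in_class[OF assms(2)] g hardy_extremal_not_AE_0[OF assms(2)]
      by (intro SUP_upper2[of ?\<psi>] SUP_upper2[of ?g]) auto
    finally show "ennreal (1 / \<bar>r - 1\<bar>)
        \<le> (SUP \<psi>\<in>Psi_class. SUP g\<in>{g \<in> grand_space r \<psi>. \<not> (AE x in weighted_measure r. g x = 0)}.
            grand_norm r (\<lambda>p. p * \<psi> p) (hardy_op r g) / grand_norm r \<psi> g)" .
  qed
  ultimately show ?thesis
    using le by blast
qed

end
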